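(* For every integer $n \geq 1$, the number of ascent sequences of length $n$ that avoid both of the patterns $201$ and $210$ equals $$\sum_{k=0}^{n-1}\binom{n-1}{k}C_k,$$ where $C_k=\frac{1}{k+1}\binom{2k}{k}$ is the $k$th Catalan number.
   Context: For an integer string $x_1\cdots x_n$, an ascent is a position $j$ with $x_j<x_{j+1}$; $\mathrm{asc}(x_1\cdots x_n)$ denotes the number of ascents. An ascent sequence of length $n$ is a sequence $x_1\cdots x_n$ of non-negative integers with $x_1=0$ and $x_i\le \mathrm{asc}(x_1\cdots x_{i-1})+1$ for $1<i\le n$. The reduction $\mathrm{red}(x)$ of an integer string $x$ is obtained by replacing every occurrence of the $i$th smallest distinct value of $x$ by $i-1$; a pattern is a reduced string (so patterns may have repeated letters and have minimum letter $0$). A string $x=x_1\cdots x_n$ contains a pattern $p=p_1\cdots p_k$ if there are indices $1\le i_1<\cdots<i_k\le n$ with $\mathrm{red}(x_{i_1}\cdots x_{i_k})=p$; otherwise $x$ avoids $p$. *)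

theory Defs
  imports Complex_Main
begin

definition asc :: "'a::linorder list \<Rightarrow> nat" where
  "asc xs = card {j. Suc j < length xs \<and> xs ! j < xs ! Suc j}"

text \<open>Lists are indexed from 0, so \<open>take i xs\<close> consists of all entries preceding \<open>xs ! i\<close>.\<close>

definition ascent_sequence :: "nat list \<Rightarrow> bool" where
  "ascent_sequence xs \<longleftrightarrow>
     xs \<noteq> [] \<and> xs ! 0 = 0 \<and>
     (\<forall>i. 1 \<le> i \<and> i < length xs \<longrightarrow> xs ! i \<le> asc (take i xs) + 1)"

text \<open>The letter \<open>a\<close> of \<open>xs\<close> is the \<open>i\<close>th smallest distinct value of \<open>xs\<close> iff exactly
  \<open>i - 1\<close> distinct values of \<open>xs\<close> are smaller than \<open>a\<close>.\<close>

definition red :: "'a::linorder list \<Rightarrow> nat list" where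
  "red xs = map (\<lambda>a. card {b \<in> set xs. b < a}) xs"

definition contains_pattern :: "'a::linorder list \<Rightarrow> nat list \<Rightarrow> bool" where
  "contains_pattern xs p \<longleftrightarrow>
     (\<exists>js. sorted_wrt (<) js \<and> (\<forall>j \<in> set js. j < length xs) \<and> red (map (\<lambda>j. xs ! j) js) = p)"

definition avoids_pattern :: "'a::linorder list \<Rightarrow> nat list \<Rightarrow> bool" where
  "avoids_pattern xs p \<longleftrightarrow> \<not> contains_pattern xs p"

definition catalan :: "nat \<Rightarrow> real" where
  "catalan k = 1 / (real k + 1) * real ((2 * k) choose k)"

end

theory Submission
  imports Defs "HOL-Computational_Algebra.Formal_Power_Series"
begin

text \<open>A sequence avoids 201 and 210 iff, after each letter \<open>b\<close>, all later letters smaller than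
  \<open>b\<close> are equal. Build such an ascent sequence letter by letter, and let \<open>M\<close> be its maximum, \<open>p\<close> its
  number of ascents minus \<open>M\<close>, and \<open>q\<close> the number of letters below \<open>M\<close> that may follow. While the last
  letter is \<open>M\<close>, the possible continuations depend only on \<open>(p, q)\<close>: besides repeating \<open>M\<close>, one may
  climb, reaching some \<open>(r, p + q + 1 - r)\<close> with \<open>r \<le> p\<close>, or go down in \<open>q\<close> ways. A sequence
  whose last letter is below \<open>M\<close> can only repeat that letter or rise to at least \<open>M\<close>, and so
  continues exactly like one in state \<open>(p + 1, 0)\<close>.

  Since the last letter can always be repeated without changing the state, the count is the
  binomial transform of the count without repetitions. The latter is linear in \<open>q\<close>, which lets the
  recurrence be solved: its generating function in state \<open>(p, q)\<close> is
  \<open>(C - C\<^sup>2 + C\<^sup>3 - \<dots> + C\<^bsup>2p+1\<^esup>) + q x C\<^bsup>2p+3\<^esup>\<close>, where \<open>C = 1 + x C\<^sup>2\<close> is the Catalan series.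
  At \<open>(0, 0)\<close> this is \<open>C\<close>.\<close>

section \<open>The Catalan generating function\<close>

lemma catalan_0: "catalan 0 = 1"
  by (simp add: catalan_def)

text \<open>Two absorption steps on central binomial coefficients. A first-order recurrence
  translates directly into the linear differential equation used below.\<close>

lemma catalan_Suc: "real (n + 2) * catalan (Suc n) = real (4 * n + 2) * catalan n"
proof -
  have a: "Suc (2*n+1) * ((2*n+2) choose Suc n) = 2 * (2*n+1) * (2 * ((2*n) choose n))"
  proof -
    have 1: "Suc n * ((2*n+2) choose Suc n) = (2*n+2) * ((2*n+1) choose n)"
      using Suc_times_binomial_eq[of "2*n+1" n] by (simp add: mult.commute)
    have 2: "Suc n * ((2*n+1) choose n) = (2*n+1) * ((2*n) choose n)"
    proof -
      have "(2*n+1) choose n = (2*n+1) choose (Suc n)"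
        using binomial_symmetric[of n "2*n+1"] by simp
      then show ?thesis
        using Suc_times_binomial_eq[of "2*n" n] by (simp add: mult.commute)
    qed
    have "Suc n * ((2*n+2) choose Suc n) = Suc n * (2 * ((2*n+1) choose n))"
      using 1 by simp
    then have "(2*n+2) choose Suc n = 2 * ((2*n+1) choose n)"
      by (metis mult_left_cancel nat.simps(3))
    then have "Suc (2*n+1) * ((2*n+2) choose Suc n) = 4 * (Suc n * ((2*n+1) choose n))"
      by simp
    then show ?thesis
      unfolding 2 by simp
  qed
  define X Z where "X = real ((2*n+2) choose Suc n)" and "Z = real ((2*n) choose n)"
  from a have "real (Suc (2*n+1) * ((2*n+2) choose Suc n)) = real (2 * (2*n+1) * (2 * ((2*n) choose n)))"
    by presburger
  then have XZ: "(real n + 1) * X = (4 * real n + 2) * Z"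
    unfolding of_nat_mult X_def[symmetric] Z_def[symmetric] by (simp add: algebra_simps)
  have "real (n + 2) * catalan (Suc n) = X"
    by (simp add: catalan_def X_def field_simps del: binomial_Suc_Suc)
  moreover have "real (4 * n + 2) * catalan n = (4 * real n + 2) * Z / (real n + 1)"
    by (simp add: catalan_def Z_def)
  ultimately show ?thesis
    by (simp flip: XZ)
qed

definition catalan_fps :: "real fps" where
  "catalan_fps = Abs_fps catalan"

text \<open>Comparing coefficients gives \<open>(n + 1) z(n+1) = 4 (n - 1) z(n)\<close>; the right
  side vanishes at \<open>n = 1\<close>, so nothing survives beyond degree one.\<close>

lemma fps_real_ode_1_minus_4X_unique:
  fixes z :: "real fps"
  assumes ode: "(1 - 4 * fps_X) * fps_deriv z = - (4 * z)" and "fps_nth z 0 = 1"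
  shows "z = 1 - 4 * fps_X"
proof -
  have step: "real (Suc n) * fps_nth z (Suc n) = 4 * (real n - 1) * fps_nth z n" for n
  proof -
    have "fps_nth ((1 - 4 * fps_X) * fps_deriv z) n = fps_nth (- (4 * z)) n"
      using ode by simp
    then show ?thesis
      by (cases n) (simp_all add: left_diff_distrib mult.assoc algebra_simps fps_numeral_fps_const)
  qed
  have one: "fps_nth z 1 = -4"
    using step[of 0] assms(2) by simp
  have zero: "fps_nth z (Suc (Suc n)) = 0" for n
  proof (induction n)
    case 0
    then show ?case using step[of 1] by simp
  next
    case (Suc n)
    then show ?case using step[of "Suc (Suc n)"] by simp
  qed
  show ?thesis
  proof (rule fps_ext)
    fix n
    show "fps_nth z n = fps_nth (1 - 4 * fps_X) n"
    proof (cases n)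
      case 0
      then show ?thesis using assms(2) by simp
    next
      case (Suc m)
      then show ?thesis using one zero
        by (cases m) (simp_all add: fps_numeral_fps_const)
    qed
  qed
qed

text \<open>The recurrence for the Catalan numbers says that \<open>y = 1 - 2xC\<close> satisfies
  \<open>(1 - 4x)y' = -2y\<close>, which forces \<open>y\<^sup>2 = 1 - 4x\<close>.\<close>

lemma catalan_fps_eq: "fps_X * catalan_fps ^ 2 = catalan_fps - 1"
proof -
  define C where "C = catalan_fps"
  define y where "y = 1 - 2 * fps_X * C"
  have nthC: "fps_nth C n = catalan n" for n
    by (simp add: C_def catalan_fps_def)
  \<comment> \<open>Coefficient \<open>m + 1\<close> of this equation is \<open>catalan_Suc\<close>
    at \<open>m\<close>.\<close>
  have odeC: "fps_X * (1 - 4 * fps_X) * fps_deriv C + (1 - 2 * fps_X) * C = 1"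
  proof (rule fps_ext)
    fix n
    define G where "G = fps_deriv C - fps_const 2 * C - fps_const 4 * (fps_X * fps_deriv C)"
    have expand: "fps_X * (1 - 4 * fps_X) * fps_deriv C + (1 - 2 * fps_X) * C = C + fps_X * G"
      by (simp add: G_def algebra_simps flip: fps_numeral_fps_const)
    show "fps_nth (fps_X * (1 - 4 * fps_X) * fps_deriv C + (1 - 2 * fps_X) * C) n = fps_nth 1 n"
    proof (cases n)
      case 0
      then show ?thesis by (simp add: nthC catalan_0)
    next
      case (Suc m)
      have "fps_nth (fps_X * fps_deriv C) m = real m * catalan m"
        by (cases m) (simp_all add: nthC)
      then have "fps_nth G m = real (m + 1) * catalan (m + 1) - 2 * catalan m - 4 * (real m * catalan m)"
        unfolding G_def fps_sub_nth fps_mult_left_const_nth by (simp add: nthC)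
      then show ?thesis
        using catalan_Suc[of m] unfolding expand Suc by (simp add: nthC algebra_simps)
    qed
  qed
  have dy: "(1 - 4 * fps_X) * fps_deriv y = - (2 * y)"
  proof -
    have y': "fps_deriv y = - (2 * C) - 2 * fps_X * fps_deriv C"
      by (simp add: y_def algebra_simps)
    have "(1 - 4 * fps_X) * fps_deriv y =
        - 2 * (fps_X * (1 - 4 * fps_X) * fps_deriv C + (1 - 2 * fps_X) * C) + 4 * fps_X * C"
      unfolding y' by (simp add: algebra_simps)
    then show ?thesis
      unfolding odeC by (simp add: y_def algebra_simps)
  qed
  have "(1 - 4 * fps_X) * fps_deriv (y ^ 2) = - (4 * y ^ 2)"
  proof -
    have "(1 - 4 * fps_X) * fps_deriv (y ^ 2) = 2 * y * ((1 - 4 * fps_X) * fps_deriv y)"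
      by (simp add: power2_eq_square algebra_simps)
    then show ?thesis
      unfolding dy by (simp add: power2_eq_square algebra_simps)
  qed
  moreover have "fps_nth (y ^ 2) 0 = 1"
    by (simp add: y_def power2_eq_square)
  ultimately have "y ^ 2 = 1 - 4 * fps_X"
    by (rule fps_real_ode_1_minus_4X_unique)
  \<comment> \<open>This is the claim times \<open>4 * fps_X\<close>, which cancels because real
    power series form an integral domain.\<close>
  then have "4 * fps_X * (fps_X * C ^ 2) = 4 * fps_X * (C - 1)"
    by (simp add: y_def power2_eq_square algebra_simps)
  then show ?thesis
    by (simp add: C_def)
qed

section \<open>The counting recurrence\<close>

text \<open>Repetitions of the last letter are excluded here and restored in
  \<open>lazy_growth\<close>. A climb adds one ascent; if it lifts the maximum by \<open>d\<close>,
  then \<open>p\<close> becomes \<open>r = p + 1 - d\<close>, and the \<open>d\<close> letters from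
  the old maximum to just below the new one are added to \<open>q\<close>.\<close>

fun growth :: "nat \<Rightarrow> nat \<Rightarrow> nat \<Rightarrow> nat" where
  "growth 0 p q = 1"
| "growth (Suc n) p q = (\<Sum>r\<le>p. growth n r (p + q + 1 - r)) + q * growth n (p + 1) 0"

fun lazy_growth :: "nat \<Rightarrow> nat \<Rightarrow> nat \<Rightarrow> nat" where
  "lazy_growth 0 p q = 1"
| "lazy_growth (Suc n) p q = lazy_growth n p q +
     (\<Sum>r\<le>p. lazy_growth n r (p + q + 1 - r)) + q * lazy_growth n (p + 1) 0"

section \<open>The binomial transform that accounts for repetitions\<close>

lemma sum_binomial_Suc:
  fixes f :: "nat \<Rightarrow> nat"
  shows "(\<Sum>k\<le>Suc n. (Suc n choose k) * f k) =
    (\<Sum>k\<le>n. (n choose k) * f k) + (\<Sum>k\<le>n. (n choose k) * f (Suc k))"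
proof -
  have "(\<Sum>k\<le>Suc n. (Suc n choose k) * f k) =
      f 0 + (\<Sum>k\<le>n. (n choose Suc k) * f (Suc k)) + (\<Sum>k\<le>n. (n choose k) * f (Suc k))"
    by (simp add: sum.atMost_Suc_shift sum.distrib algebra_simps del: sum.atMost_Suc)
  moreover have "f 0 + (\<Sum>k\<le>n. (n choose Suc k) * f (Suc k)) = (\<Sum>k\<le>Suc n. (n choose k) * f k)"
    by (simp add: sum.atMost_Suc_shift del: sum.atMost_Suc)
  ultimately show ?thesis by simp
qed

text \<open>Choose which \<open>k\<close> of the \<open>n\<close> steps change the letter; the
  others keep the state. Pascal's rule matches the extra summand of
  \<open>lazy_growth\<close>.\<close>

lemma lazy_growth_eq_sum_growth: "lazy_growth n p q = (\<Sum>k\<le>n. (n choose k) * growth k p q)"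
proof (induction n arbitrary: p q)
  case 0
  then show ?case by simp
next
  case (Suc n)
  have "(\<Sum>k\<le>n. (n choose k) * growth (Suc k) p q) =
      (\<Sum>r\<le>p. \<Sum>k\<le>n. (n choose k) * growth k r (p + q + 1 - r)) +
      q * (\<Sum>k\<le>n. (n choose k) * growth k (p + 1) 0)"
    by (subst sum.swap)
      (simp add: distrib_left sum.distrib sum_distrib_left mult.left_commute)
  then show ?case
    unfolding sum_binomial_Suc by (simp add: Suc.IH)
qed

text \<open>By \<open>x C\<^sup>2 = C - 1\<close>, this is \<open>C - C\<^sup>2 + C\<^sup>3 - \<dots> + C\<^bsup>2p+1\<^esup>\<close>.\<close>

fun growth_gf :: "nat \<Rightarrow> real fps" where
  "growth_gf 0 = catalan_fps"
| "growth_gf (Suc p) = growth_gf p + fps_X * catalan_fps ^ (2 * p + 4)"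

text \<open>Translates the recursion of \<open>growth\<close> to the claimed series
  \<open>F(p, q)\<close>; the last summand on the left is \<open>q x F(p + 1, 0)\<close>.\<close>

lemma growth_gf_recurrence:
  "1 + fps_X * (\<Sum>r\<le>p. growth_gf r + of_nat (p + q + 1 - r) * fps_X * catalan_fps ^ (2 * r + 3))
     + of_nat q * fps_X * growth_gf (p + 1)
   = growth_gf p + of_nat q * fps_X * catalan_fps ^ (2 * p + 3)"
proof (induction p arbitrary: q)
  case 0
  define C where "C = catalan_fps"
  have "fps_X * C ^ 2 = C - 1"
    by (simp add: C_def catalan_fps_eq)
  then have "1 + fps_X * (C + (of_nat q + 1) * fps_X * C ^ 3) + of_nat q * fps_X * (C + fps_X * C ^ 4)
      = C + of_nat q * fps_X * C ^ 3"
    by algebra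
  then show ?case
    by (simp add: C_def algebra_simps)
next
  case (Suc p)
  define C where "C = catalan_fps"
  \<comment> \<open>Since \<open>(p + 1) + q = p + (q + 1)\<close>, the sum for \<open>p + 1\<close>
    at \<open>q\<close> is the sum for \<open>p\<close> at \<open>q + 1\<close> plus the term
    \<open>r = p + 1\<close>, whose multiplicity is \<open>q + 1\<close>. Hence the induction
    hypothesis is taken at \<open>Suc q\<close>.\<close>
  define S where "S = (\<Sum>r\<le>p. growth_gf r + of_nat (p + Suc q + 1 - r) * fps_X * C ^ (2 * r + 3))"
  define D where "D = C ^ (2 * p + 3)"
  define A where "A = growth_gf p"
  have c: "fps_X * C ^ 2 = C - 1"
    by (simp add: C_def catalan_fps_eq)
  have pw: "C ^ (2 * p + 4) = D * C" "C ^ (2 * Suc p + 3) = D * C ^ 2" "C ^ (2 * Suc p + 4) = D * C ^ 3"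
    by (simp_all add: D_def eval_nat_numeral)
  have IH: "1 + fps_X * S + (of_nat q + 1) * fps_X * (A + fps_X * (D * C))
      = A + (of_nat q + 1) * fps_X * D"
    using Suc.IH[of "Suc q"] unfolding growth_gf.simps Suc_eq_plus1[symmetric]
    unfolding C_def[symmetric] pw
    by (simp add: S_def D_def A_def C_def[symmetric] pw add.commute)
  have "1 + fps_X * (S + (A + fps_X * (D * C) + (of_nat q + 1) * fps_X * (D * C ^ 2)))
      + of_nat q * fps_X * (A + fps_X * (D * C) + fps_X * (D * C ^ 3))
    = A + fps_X * (D * C) + of_nat q * fps_X * (D * C ^ 2)"
    using IH c by algebra
  then show ?case
    unfolding Suc_eq_plus1[symmetric] growth_gf.simps sum.atMost_Suc C_def[symmetric] pw
    by (simp add: S_def A_def add.commute)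
qed

text \<open>In degree \<open>n + 1\<close> the constant \<open>1\<close> disappears and the factor
  \<open>x\<close> shifts the index, so \<open>growth_gf_recurrence\<close> becomes the recursion
  defining \<open>growth\<close>.\<close>

lemma growth_eq_coeff:
  "real (growth n p q) =
     fps_nth (growth_gf p + of_nat q * fps_X * catalan_fps ^ (2 * p + 3)) n"
proof (induction n arbitrary: p q)
  case 0
  have "fps_nth (growth_gf p) 0 = 1"
    by (induction p) (simp_all add: catalan_fps_def catalan_0)
  then show ?case by (simp add: mult.assoc)
next
  case (Suc n)
  let ?F = "\<lambda>p q. growth_gf p + of_nat q * fps_X * catalan_fps ^ (2 * p + 3)"
  have "?F p q = 1 + fps_X * ((\<Sum>r\<le>p. ?F r (p + q + 1 - r)) + of_nat q * ?F (p + 1) 0)"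
    by (subst growth_gf_recurrence[symmetric]) (simp add: algebra_simps)
  then have "fps_nth (?F p q) (Suc n) =
      fps_nth ((\<Sum>r\<le>p. ?F r (p + q + 1 - r)) + of_nat q * ?F (p + 1) 0) n"
    by (metis (no_types, lifting) add_0 diff_Suc_1 fps_X_mult_nth fps_add_nth fps_one_nth nat.simps(3))
  also have "\<dots> = real (growth (Suc n) p q)"
    by (simp add: fps_sum_nth Suc.IH fps_of_nat[symmetric] del: growth_gf.simps)
  finally show ?case by simp
qed

lemma growth_0_0: "real (growth n 0 0) = catalan n"
  by (simp add: growth_eq_coeff catalan_fps_def)

section \<open>Pattern avoidance\<close>

definition uniform_below :: "nat list \<Rightarrow> bool" where
  "uniform_below xs \<longleftrightarrow>
     (\<forall>i j k. i < j \<and> j < k \<and> k < length xs \<and> xs ! j < xs ! i \<and> xs ! k < xs ! i \<longrightarrow> xs ! j = xs ! k)"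

text \<open>Lets the simplifier evaluate the cardinalities in \<open>red\<close> on an explicit
  list.\<close>

lemma Collect_insert_less:
  "{z \<in> insert a A. z < d} = (if a < d then insert a {z \<in> A. z < d} else {z \<in> A. z < d})"
  by auto

lemma red_201_iff: "red [a, b, c] = [2, 0, 1] \<longleftrightarrow> b < c \<and> c < (a :: nat)"
  unfolding red_def list.set list.map Collect_insert_less
  by (auto simp: card_insert_if split: if_splits)

lemma red_210_iff: "red [a, b, c] = [2, 1, 0] \<longleftrightarrow> c < b \<and> b < (a :: nat)"
  unfolding red_def list.set list.map Collect_insert_less
  by (auto simp: card_insert_if split: if_splits)

text \<open>Reduction preserves length, so the index list of an occurrence has exactly three
  entries.\<close>

lemma contains_pattern_length_3:
  assumes "length p = 3"
  shows "contains_pattern xs p \<longleftrightarrow>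
    (\<exists>i j k. i < j \<and> j < k \<and> k < length xs \<and> red [xs ! i, xs ! j, xs ! k] = p)"
proof
  assume "contains_pattern xs p"
  then obtain js where js: "sorted_wrt (<) js" "\<forall>j \<in> set js. j < length xs"
    "red (map (\<lambda>j. xs ! j) js) = p"
    by (auto simp: contains_pattern_def)
  then have "length js = 3"
    using assms by (auto simp: red_def)
  then obtain i j k where "js = [i, j, k]"
    by (auto simp: eval_nat_numeral length_Suc_conv)
  then show "\<exists>i j k. i < j \<and> j < k \<and> k < length xs \<and> red [xs ! i, xs ! j, xs ! k] = p"
    using js by auto
next
  assume "\<exists>i j k. i < j \<and> j < k \<and> k < length xs \<and> red [xs ! i, xs ! j, xs ! k] = p"
  then obtain i j k where "i < j" "j < k" "k < length xs" "red [xs ! i, xs ! j, xs ! k] = p"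
    by blast
  then show "contains_pattern xs p"
    unfolding contains_pattern_def by (intro exI[of _ "[i, j, k]"]) auto
qed

text \<open>The two patterns are the two orders in which distinct letters can follow a larger
  one.\<close>

lemma avoids_iff_uniform_below:
  "avoids_pattern xs [2, 0, 1] \<and> avoids_pattern xs [2, 1, 0] \<longleftrightarrow> uniform_below xs"
proof -
  have "red [a, b, c] = [2, 0, 1] \<or> red [a, b, c] = [2, 1, 0] \<longleftrightarrow> b < a \<and> c < a \<and> b \<noteq> c"
    for a b c :: nat
    unfolding red_201_iff red_210_iff by auto
  moreover have "contains_pattern xs [2, 0, 1] \<or> contains_pattern xs [2, 1, 0] \<longleftrightarrow>
    (\<exists>i j k. i < j \<and> j < k \<and> k < length xs \<and>
      (red [xs ! i, xs ! j, xs ! k] = [2, 0, 1] \<or> red [xs ! i, xs ! j, xs ! k] = [2, 1, 0]))"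
    by (subst (1 2) contains_pattern_length_3) (simp_all only: list.size, auto)
  ultimately have "contains_pattern xs [2, 0, 1] \<or> contains_pattern xs [2, 1, 0] \<longleftrightarrow>
      \<not> uniform_below xs"
    unfolding uniform_below_def by blast
  then show ?thesis
    unfolding avoids_pattern_def by blast
qed

text \<open>The new letter can only be the third entry of a triple.\<close>

lemma uniform_below_snoc:
  "uniform_below (xs @ [y]) \<longleftrightarrow> uniform_below xs \<and>
     (\<forall>i j. i < j \<and> j < length xs \<and> xs ! j < xs ! i \<and> y < xs ! i \<longrightarrow> y = xs ! j)"
  (is "?L \<longleftrightarrow> ?R")
proof
  assume L: ?L
  show ?R
  proof (intro conjI allI impI)
    show "uniform_below xs"
      unfolding uniform_below_def
    proof (intro allI impI)
      fix i j k
      assume "i < j \<and> j < k \<and> k < length xs \<and> xs ! j < xs ! i \<and> xs ! k < xs ! i"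
      then show "xs ! j = xs ! k"
        using L[unfolded uniform_below_def, rule_format, of i j k] by (simp add: nth_append)
    qed
  next
    fix i j
    assume "i < j \<and> j < length xs \<and> xs ! j < xs ! i \<and> y < xs ! i"
    then show "y = xs ! j"
      using L[unfolded uniform_below_def, rule_format, of i j "length xs"] by (simp add: nth_append)
  qed
next
  assume R: ?R
  show ?L
    unfolding uniform_below_def
  proof (intro allI impI)
    fix i j k
    assume *: "i < j \<and> j < k \<and> k < length (xs @ [y]) \<and> (xs @ [y]) ! j < (xs @ [y]) ! i \<and>
      (xs @ [y]) ! k < (xs @ [y]) ! i"
    show "(xs @ [y]) ! j = (xs @ [y]) ! k"
    proof (cases "k = length xs")
      case True
      then have ij: "i < j" "j < length xs" "i < length xs"
        using * by auto
      have eqs: "(xs @ [y]) ! i = xs ! i" "(xs @ [y]) ! j = xs ! j" "(xs @ [y]) ! k = y"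
        using True ij(2,3) by (simp_all add: nth_append)
      then show ?thesis
        using R ij * unfolding eqs by metis
    next
      case False
      then have "i < length xs" "j < length xs" "k < length xs"
        using * by auto
      then have eqs: "(xs @ [y]) ! i = xs ! i" "(xs @ [y]) ! j = xs ! j" "(xs @ [y]) ! k = xs ! k"
        by (simp_all add: nth_append)
      show ?thesis
        using R * \<open>k < length xs\<close> unfolding eqs uniform_below_def by metis
    qed
  qed
qed

lemma asc_snoc:
  assumes "xs \<noteq> []"
  shows "asc (xs @ [y]) = asc xs + (if last xs < y then 1 else 0)"
proof -
  let ?A = "{j. Suc j < length xs \<and> xs ! j < xs ! Suc j}"
  have fin: "finite ?A"
    by (rule finite_subset[of _ "{..<length xs}"]) auto
  obtain l where l: "length xs = Suc l"
    using assms by (cases xs) auto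
  then have "last xs = xs ! l"
    using assms by (simp add: last_conv_nth)
  then have "{j. Suc j < length (xs @ [y]) \<and> (xs @ [y]) ! j < (xs @ [y]) ! Suc j} =
      ?A \<union> (if last xs < y then {l} else {})"
    using l by (auto simp: nth_append less_Suc_eq)
  then show ?thesis
    using fin l unfolding asc_def by (auto simp: card_insert_if)
qed

section \<open>Extending a sequence letter by letter\<close>

definition valid :: "nat list \<Rightarrow> bool" where
  "valid xs \<longleftrightarrow> ascent_sequence xs \<and> uniform_below xs"

text \<open>Its cardinality is the parameter \<open>q\<close>. For ascent sequences,
  \<open>Max_le_asc\<close> makes these letters satisfy the ascent bound.\<close>

definition down_letters :: "nat list \<Rightarrow> nat set" where
  "down_letters xs = {y. y < Max (set xs) \<and> uniform_below (xs @ [y])}"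

definition extensions :: "nat \<Rightarrow> nat list \<Rightarrow> nat list set" where
  "extensions m xs = {zs. length zs = m \<and> valid (xs @ zs)}"

lemma ascent_sequence_snoc:
  assumes "xs \<noteq> []"
  shows "ascent_sequence (xs @ [y]) \<longleftrightarrow> ascent_sequence xs \<and> y \<le> asc xs + 1"
proof -
  have "(\<forall>i. 1 \<le> i \<and> i < length (xs @ [y]) \<longrightarrow> (xs @ [y]) ! i \<le> asc (take i (xs @ [y])) + 1) \<longleftrightarrow>
    (\<forall>i. 1 \<le> i \<and> i < length xs \<longrightarrow> xs ! i \<le> asc (take i xs) + 1) \<and> y \<le> asc xs + 1"
    using assms by (auto simp: nth_append less_Suc_eq Suc_le_eq)
  then show ?thesis
    using assms by (simp add: ascent_sequence_def nth_append)
qed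

lemma ascent_sequence_append:
  assumes "xs \<noteq> []" "ascent_sequence (xs @ zs)"
  shows "ascent_sequence xs"
  using assms(2)
proof (induction zs rule: rev_induct)
  case (snoc z zs)
  then show ?case
    using ascent_sequence_snoc[of "xs @ zs" z] assms(1) by simp
qed simp

lemma uniform_below_append: "uniform_below (xs @ zs) \<Longrightarrow> uniform_below xs"
proof (induction zs rule: rev_induct)
  case (snoc z zs)
  then show ?case
    using uniform_below_snoc[of "xs @ zs" z] by simp
qed simp

lemma valid_append: "xs \<noteq> [] \<Longrightarrow> valid (xs @ zs) \<Longrightarrow> valid xs"
  by (auto simp: valid_def intro: ascent_sequence_append uniform_below_append)

lemma valid_nonempty: "valid xs \<Longrightarrow> xs \<noteq> []"
  by (simp add: valid_def ascent_sequence_def)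

lemma Max_snoc: "xs \<noteq> [] \<Longrightarrow> Max (set (xs @ [y])) = max (Max (set xs)) (y :: nat)"
  by (simp add: max.commute)

lemma nth_le_Max: "i < length xs \<Longrightarrow> xs ! i \<le> Max (set xs)"
  by simp

text \<open>Only \<open>y = asc xs + 1\<close> could exceed the old number of ascents, and then
  \<open>y\<close> exceeds the last letter and creates a new one. Thus the subtraction in
  \<open>p = asc xs - Max (set xs)\<close> never truncates.\<close>

lemma Max_le_asc: "ascent_sequence xs \<Longrightarrow> Max (set xs) \<le> asc xs"
proof (induction xs rule: rev_induct)
  case Nil
  then show ?case by (simp add: ascent_sequence_def)
next
  case (snoc y xs)
  show ?case
  proof (cases "xs = []")
    case True
    then show ?thesis using snoc.prems by (simp add: ascent_sequence_def)
  next
    case False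
    then have "ascent_sequence xs" and y: "y \<le> asc xs + 1"
      using snoc.prems by (simp_all add: ascent_sequence_snoc)
    then have M: "Max (set xs) \<le> asc xs"
      using snoc.IH by blast
    moreover have "last xs \<le> asc xs"
      using False M by simp
    ultimately have "max (Max (set xs)) y \<le> asc xs + (if last xs < y then 1 else 0)"
      using y by (simp del: Max_le_iff)
    then show ?thesis
      unfolding Max_snoc[OF False] asc_snoc[OF False] .
  qed
qed

section \<open>Which letters may be appended\<close>

lemma uniform_below_snoc_ge_Max:
  assumes "uniform_below xs" "Max (set xs) \<le> y"
  shows "uniform_below (xs @ [y])"
proof -
  have "\<not> y < xs ! i" if "i < length xs" for i
    using nth_le_Max[OF that] assms(2) by simp
  then show ?thesis
    using assms(1) by (auto simp: uniform_below_snoc)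
qed

lemma finite_down_letters: "finite (down_letters xs)"
  by (simp add: down_letters_def)

lemma valid_letters:
  assumes "valid xs"
  shows "{y. valid (xs @ [y])} = down_letters xs \<union> {Max (set xs)..asc xs + 1}"
proof -
  define M where "M = Max (set xs)"
  have "M \<le> asc xs" "xs \<noteq> []" "ascent_sequence xs"
    using assms Max_le_asc valid_nonempty by (auto simp: valid_def M_def simp del: Max_le_iff)
  moreover have "uniform_below (xs @ [y])" if "M \<le> y" for y
    using assms that by (simp add: valid_def M_def uniform_below_snoc_ge_Max)
  ultimately show ?thesis
    unfolding down_letters_def M_def[symmetric] by (auto simp: valid_def ascent_sequence_snoc)
qed

text \<open>A letter at or above the maximum ends no strictly decreasing pair, so it imposes no new
  constraint; it only makes the letters in \<open>{Max (set xs)..<y}\<close> count as lying below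
  the maximum.\<close>

lemma down_letters_up:
  assumes ne: "xs \<noteq> []" and U: "uniform_below xs" and y: "Max (set xs) \<le> y"
  shows "down_letters (xs @ [y]) = down_letters xs \<union> {Max (set xs)..<y}"
proof -
  define M where "M = Max (set xs)"
  have My: "M \<le> y"
    using y by (simp only: M_def)
  have le_y: "\<not> y < xs ! i" if "i < length xs" for i
    using nth_le_Max[OF that] My by (simp only: M_def)
  have Uy: "uniform_below (xs @ [y])"
    by (rule uniform_below_snoc_ge_Max[OF U y])
  have pairs: "(i < j \<and> j < length (xs @ [y]) \<and> (xs @ [y]) ! j < (xs @ [y]) ! i \<and> z < (xs @ [y]) ! i
      \<longrightarrow> z = (xs @ [y]) ! j) \<longleftrightarrow>
    (i < j \<and> j < length xs \<and> xs ! j < xs ! i \<and> z < xs ! i \<longrightarrow> z = xs ! j)" for i j z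
  proof (cases "i < j \<and> j < length xs")
    case True
    then have "i < length xs" by simp
    then show ?thesis
      using True by (simp add: nth_append)
  next
    case False
    have "\<not> (xs @ [y]) ! j < (xs @ [y]) ! i" if "i < j" "j < length (xs @ [y])"
    proof -
      have "j = length xs" "i < length xs"
        using False that by auto
      then show ?thesis
        using le_y[of i] by (simp add: nth_append)
    qed
    then show ?thesis
      using False by blast
  qed
  have iff: "uniform_below ((xs @ [y]) @ [z]) \<longleftrightarrow> uniform_below (xs @ [z])" for z
    unfolding uniform_below_snoc[of "xs @ [y]" z] uniform_below_snoc[of xs z] pairs
    using Uy U by blast
  have "Max (set (xs @ [y])) = y"
    using My unfolding Max_snoc[OF ne] M_def by (rule max_absorb2)
  moreover have "uniform_below (xs @ [z])" if "M \<le> z" for z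
    using uniform_below_snoc_ge_Max[OF U] that by (simp only: M_def)
  ultimately show ?thesis
    unfolding down_letters_def iff M_def[symmetric] using My
    by (simp only:) (auto simp: not_less)
qed

lemma card_down_letters_up:
  assumes "xs \<noteq> []" "uniform_below xs" "Max (set xs) \<le> y"
  shows "card (down_letters (xs @ [y])) = card (down_letters xs) + (y - Max (set xs))"
proof -
  have "down_letters xs \<inter> {Max (set xs)..<y} = {}"
    by (auto simp: down_letters_def)
  then show ?thesis
    by (simp add: down_letters_up[OF assms] card_Un_disjoint finite_down_letters)
qed

text \<open>The maximum and the last letter form a decreasing pair, which forces every further
  letter below the maximum to equal the last one.\<close>

lemma down_letters_below_Max:
  assumes U: "uniform_below xs" and ne: "xs \<noteq> []" and last: "last xs < Max (set xs)"
  shows "down_letters xs = {last xs}"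
proof -
  have "Max (set xs) \<in> set xs"
    using ne by simp
  then obtain i where i: "i < length xs" "xs ! i = Max (set xs)"
    by (auto simp: in_set_conv_nth)
  define l where "l = length xs - 1"
  have l: "xs ! l = last xs" "l < length xs"
    using ne by (auto simp: last_conv_nth l_def)
  have "i < l"
    using i l last by (metis l_def Suc_pred' length_greater_0_conv ne less_antisym less_irrefl)
  have "z = last xs" if "z \<in> down_letters xs" for z
  proof -
    have "uniform_below (xs @ [z])" "z < xs ! i"
      using that i by (simp_all add: down_letters_def)
    then have "z = xs ! l"
      using \<open>i < l\<close> l i last unfolding uniform_below_snoc by metis
    then show ?thesis by (simp add: l)
  qed
  moreover have "last xs \<in> down_letters xs"
  proof -
    \<comment> \<open>If \<open>j\<close> is not the last position, then \<open>i'\<close>,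
      \<open>j\<close> and the last position form a triple already constrained within
      \<open>xs\<close>.\<close>
    have "last xs = xs ! j" if "i' < j" "j < length xs" "xs ! j < xs ! i'" "last xs < xs ! i'" for i' j
    proof (cases "j = l")
      case False
      then have "j < l" using that(2) by (simp add: l_def)
      then show ?thesis
        using U that l unfolding uniform_below_def by metis
    qed (use l in simp)
    then show ?thesis
      using U last by (auto simp: down_letters_def uniform_below_snoc)
  qed
  ultimately show ?thesis by blast
qed

section \<open>Counting extensions by state\<close>

lemma extensions_Suc:
  "extensions (Suc m) xs = (\<Union>y \<in> {y. valid (xs @ [y])}. (#) y ` extensions m (xs @ [y]))"
proof (intro equalityI subsetI)
  fix zs
  assume "zs \<in> extensions (Suc m) xs"
  then obtain y ys where "zs = y # ys" "length ys = m" "valid ((xs @ [y]) @ ys)"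
    by (auto simp: extensions_def length_Suc_conv)
  then show "zs \<in> (\<Union>y \<in> {y. valid (xs @ [y])}. (#) y ` extensions m (xs @ [y]))"
    using valid_append[of "xs @ [y]" ys] by (auto simp: extensions_def)
qed (auto simp: extensions_def)

lemma finite_valid_letters: "valid xs \<Longrightarrow> finite {y. valid (xs @ [y])}"
  by (simp add: valid_letters finite_down_letters)

lemma finite_extensions: "valid xs \<Longrightarrow> finite (extensions m xs)"
proof (induction m arbitrary: xs)
  case 0
  then show ?case by (simp add: extensions_def)
next
  case (Suc m)
  then show ?case
    by (simp add: extensions_Suc finite_valid_letters)
qed

lemma card_extensions_Suc:
  assumes "valid xs"
  shows "card (extensions (Suc m) xs) = (\<Sum>y \<in> {y. valid (xs @ [y])}. card (extensions m (xs @ [y])))"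
proof -
  have "card (extensions (Suc m) xs) =
      (\<Sum>y \<in> {y. valid (xs @ [y])}. card ((#) y ` extensions m (xs @ [y])))"
    unfolding extensions_Suc
    by (rule card_UN_disjoint) (use finite_valid_letters[OF assms] finite_extensions in auto)
  then show ?thesis
    by (simp add: card_image)
qed

lemma sum_reflect: "(\<Sum>y\<in>{b - c..b::nat}. f y) = (\<Sum>r\<le>c. f (b - r))" if "c \<le> b"
  by (rule sum.reindex_bij_witness[of _ "\<lambda>r. b - r" "\<lambda>y. b - y"]) (use that in auto)

text \<open>Induction on \<open>m\<close>, splitting the next letter at the maximum. In the
  \<open>else\<close> branch every move other than a repetition is a rise to at least the maximum
  and gains an ascent; the \<open>+ 1\<close> anticipates that ascent.\<close>

lemma card_extensions:
  assumes "valid xs"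
  shows "card (extensions m xs) =
    (if last xs = Max (set xs) then lazy_growth m (asc xs - Max (set xs)) (card (down_letters xs))
     else lazy_growth m (asc xs - Max (set xs) + 1) 0)"
  using assms
proof (induction m arbitrary: xs)
  case 0
  then have "extensions 0 xs = {[]}"
    by (auto simp: extensions_def)
  then show ?case by simp
next
  case (Suc m)
  define M a D where "M = Max (set xs)" and "a = asc xs" and "D = down_letters xs"
  let ?c = "\<lambda>y. card (extensions m (xs @ [y]))"
  have ne: "xs \<noteq> []" and U: "uniform_below xs"
    using Suc.prems valid_nonempty by (auto simp: valid_def)
  have Ma: "M \<le> a"
    using Suc.prems by (simp add: M_def a_def valid_def Max_le_asc)
  have last_le: "last xs \<le> M"
    using ne by (simp add: M_def)
  have letters: "{y. valid (xs @ [y])} = D \<union> {M..a + 1}"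
    using valid_letters[OF Suc.prems] by (simp add: D_def M_def a_def)
  have D_less: "y < M" if "y \<in> D" for y
    using that by (simp add: D_def M_def down_letters_def)
  have total: "card (extensions (Suc m) xs) = (\<Sum>y\<in>D. ?c y) + (\<Sum>y\<in>{M..a + 1}. ?c y)"
    unfolding card_extensions_Suc[OF Suc.prems] letters
  proof (rule sum.union_disjoint)
    show "D \<inter> {M..a + 1} = {}"
      using D_less by fastforce
    show "finite D"
      by (simp add: D_def finite_down_letters)
  qed simp
  have down: "?c y = lazy_growth m (a - M + 1) 0" if "y \<in> D" for y
  proof -
    \<comment> \<open>A down letter never creates an ascent: if the last letter is already below the
      maximum, the only down letter repeats it.\<close>
    have "last xs < y \<Longrightarrow> D = {last xs}"
      using down_letters_below_Max[OF U ne] D_less[OF that] by (simp add: D_def M_def)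
    then have "\<not> last xs < y"
      using that by auto
    then have "asc (xs @ [y]) = a"
      by (simp add: asc_snoc ne a_def)
    moreover have "Max (set (xs @ [y])) = M"
      using D_less[OF that] Max_snoc[OF ne] by (simp add: M_def del: set_append)
    moreover have "valid (xs @ [y])"
      using letters that by auto
    ultimately show ?thesis
      using D_less[OF that] Suc.IH[of "xs @ [y]"] by (simp del: set_append)
  qed
  have up: "?c y = lazy_growth m (a + (if last xs < y then 1 else 0) - y) (card D + (y - M))"
    if "M \<le> y" "y \<le> a + 1" for y
  proof -
    have valid_y: "valid (xs @ [y])"
      using letters that by auto
    have Max_y: "Max (set (xs @ [y])) = y"
      unfolding Max_snoc[OF ne] M_def[symmetric] using that(1) by (rule max_absorb2)
    have asc_y: "asc (xs @ [y]) = a + (if last xs < y then 1 else 0)"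
      by (simp add: asc_snoc ne a_def)
    have card_y: "card (down_letters (xs @ [y])) = card D + (y - M)"
      using card_down_letters_up[OF ne U, of y] that(1) by (simp only: M_def D_def)
    show ?thesis
      unfolding Suc.IH[OF valid_y] Max_y card_y asc_y last_snoc by (simp only: if_True refl)
  qed
  show ?case
  proof (cases "last xs = M")
    case True
    \<comment> \<open>Here \<open>M\<close> repeats the last letter and creates no ascent, so it is
      split off; the letters above it are indexed by the new excess
      \<open>r = a + 1 - y\<close>.\<close>
    have "(\<Sum>y\<in>{M..a + 1}. ?c y) = ?c M + (\<Sum>y\<in>{a + 1 - (a - M)..a + 1}. ?c y)"
      using Ma by (subst sum.atLeast_Suc_atMost) (simp_all add: Suc_diff_le)
    also have "?c M = lazy_growth m (a - M) (card D)"
      using up[of M] Ma True by simp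
    also have "(\<Sum>y\<in>{a + 1 - (a - M)..a + 1}. ?c y) = (\<Sum>r\<le>a - M. ?c (a + 1 - r))"
      by (rule sum_reflect) simp
    also have "\<dots> = (\<Sum>r\<le>a - M. lazy_growth m r (a - M + card D + 1 - r))"
    proof (rule sum.cong[OF refl])
      fix r
      assume r: "r \<in> {..a - M}"
      then have "last xs < a + 1 - r" "a + 1 - (a + 1 - r) = r"
        "card D + (a + 1 - r - M) = a - M + card D + 1 - r"
        using Ma True by auto
      then show "?c (a + 1 - r) = lazy_growth m r (a - M + card D + 1 - r)"
        using up[of "a + 1 - r"] r Ma by simp
    qed
    finally show ?thesis
      using True down by (simp add: total M_def[symmetric] a_def[symmetric] D_def[symmetric])
  next
    case False
    then have less: "last xs < M"
      using last_le by simp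
    have D: "D = {last xs}"
      using down_letters_below_Max[OF U ne] less by (simp add: D_def M_def)
    \<comment> \<open>Now \<open>M\<close> itself is a rise, giving \<open>r = a + 1 - M\<close>;
      the repetition comes from the single element of \<open>D\<close> instead.\<close>
    have "(\<Sum>y\<in>{M..a + 1}. ?c y) = (\<Sum>y\<in>{a + 1 - (a + 1 - M)..a + 1}. ?c y)"
      using Ma by simp
    also have "\<dots> = (\<Sum>r\<le>a + 1 - M. ?c (a + 1 - r))"
      by (rule sum_reflect) simp
    also have "\<dots> = (\<Sum>r\<le>a - M + 1. lazy_growth m r (a - M + 1 + 0 + 1 - r))"
    proof (rule sum.cong)
      show "{..a + 1 - M} = {..a - M + 1}"
        using Ma by (simp add: Suc_diff_le)
    next
      fix r
      assume r: "r \<in> {..a - M + 1}"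
      then have "last xs < a + 1 - r" "a + 1 - (a + 1 - r) = r"
        "card D + (a + 1 - r - M) = a - M + 1 + 0 + 1 - r"
        using Ma less by (auto simp: D)
      then show "?c (a + 1 - r) = lazy_growth m r (a - M + 1 + 0 + 1 - r)"
        using up[of "a + 1 - r"] r Ma by simp
    qed
    finally show ?thesis
      using False down by (simp add: total D M_def[symmetric] a_def[symmetric])
  qed
qed

theorem theorem1:
  fixes n :: nat
  assumes "n \<ge> 1"
  shows "real (card {xs. length xs = n \<and> ascent_sequence xs \<and>
                         avoids_pattern xs [2, 0, 1] \<and> avoids_pattern xs [2, 1, 0]})
         = (\<Sum>k = 0..n - 1. real ((n - 1) choose k) * catalan k)"
proof -
  have valid_0: "valid [0]"
    by (simp add: valid_def ascent_sequence_def uniform_below_def)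
  have "{xs. length xs = n \<and> ascent_sequence xs \<and>
          avoids_pattern xs [2, 0, 1] \<and> avoids_pattern xs [2, 1, 0]} = {xs. length xs = n \<and> valid xs}"
    by (simp only: avoids_iff_uniform_below valid_def)
  also have "\<dots> = (#) 0 ` extensions (n - 1) [0]"
  proof (intro equalityI subsetI)
    fix xs
    assume "xs \<in> {xs. length xs = n \<and> valid xs}"
    then show "xs \<in> (#) 0 ` extensions (n - 1) [0]"
      by (cases xs) (auto simp: extensions_def valid_def ascent_sequence_def)
  qed (use assms in \<open>auto simp: extensions_def\<close>)
  finally have "card {xs. length xs = n \<and> ascent_sequence xs \<and>
      avoids_pattern xs [2, 0, 1] \<and> avoids_pattern xs [2, 1, 0]} = card (extensions (n - 1) [0])"
    by (simp add: card_image)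
  \<comment> \<open>For \<open>[0]\<close> the maximum is the last letter, with no ascents and
    nothing below it: state \<open>(0, 0)\<close>.\<close>
  also have "\<dots> = lazy_growth (n - 1) 0 0"
    by (simp add: card_extensions[OF valid_0] asc_def down_letters_def)
  also have "\<dots> = (\<Sum>k = 0..n - 1. ((n - 1) choose k) * growth k 0 0)"
    by (simp add: lazy_growth_eq_sum_growth atMost_atLeast0)
  finally show ?thesis
    by (simp add: growth_0_0)
qed

end
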